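(* Let $\mathbf{B}\subseteq[-1,1]^n$ be a Borel set, let $\mathcal{B}$ be the $\sigma$-algebra of Borel subsets of $\mathbf{B}$, and let $\mu_2$ be the normalized Lebesgue measure on $\mathbf{B}$, i.e. $\mu_2(\mathbf{C})=\mathrm{vol}(\mathbf{C})/2^n$ for every $\mathbf{C}\in\mathcal{B}$. Let $\mathbf{K}\in\mathcal{B}$ (so $\mathbf{K}\subseteq\mathbf{B}$) and let $p\in\mathbb{R}[x]$ be positive almost everywhere on $\mathbf{K}$. Consider the infinite-dimensional linear program $$\mathrm{P}:\quad \sup_{\mu_1}\left\{\int p\,d\mu_1\;:\;\mu_1\leq\mu_2,\ \mu_1\in M(\mathbf{K})\right\}.$$ Then the restriction $\mu_1^*$ of $\mu_2$ to $\mathbf{K}$ (that is, $\mu_1^*(\mathbf{C})=\mu_2(\mathbf{C}\cap\mathbf{K})$ for all $\mathbf{C}\in\mathcal{B}$) is the unique optimal solution of $\mathrm{P}$, and the optimal value of $\mathrm{P}$ is $\max\mathrm{P}=\int p\,d\mu_1^*=\int_{\mathbf{K}}p\,d\mu_2$. In particular, if $p\equiv1$ then $\max\mathrm{P}=\mathrm{vol}(\mathbf{K})/2^n$.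
   Context: $\mathbb{R}[x]$ is the ring of real polynomials in $x=(x_1,\ldots,x_n)$; $\mathrm{vol}$ is $n$-dimensional Lebesgue measure, and "almost everywhere" is with respect to it. $M(\mathbf{K})$ is the set of finite (nonnegative) Borel measures on $\mathbf{K}$, regarded as measures on $\mathbf{B}$ that vanish on $\mathbf{B}\setminus\mathbf{K}$. For two measures on $\mathcal{B}$, $\mu_1\leq\mu_2$ means $\mu_1(\mathbf{C})\leq\mu_2(\mathbf{C})$ for every $\mathbf{C}\in\mathcal{B}$. *)

theory Defs
  imports "HOL-Analysis.Analysis"
begin

text \<open>The normalized Lebesgue measure on the Borel subsets of \<open>B\<close>, viewed as a measure with
  underlying space \<open>B\<close>.\<close>
definition normalized_lborel :: "(real ^ 'n) set \<Rightarrow> (real ^ 'n) measure" where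
  "normalized_lborel B = scale_measure (1 / 2 ^ CARD('n)) (restrict_space lborel B)"

lemma sets_normalized_lborel: "sets (normalized_lborel B) = sets (restrict_space borel B)"
  by (simp add: normalized_lborel_def sets_restrict_space)

lemma emeasure_normalized_lborel:
  fixes B :: "(real ^ 'n) set"
  assumes "B \<in> sets borel" "C \<in> sets (restrict_space borel B)"
  shows "emeasure (normalized_lborel B) C = emeasure lborel C / 2 ^ CARD('n)"
proof -
  have "C \<subseteq> B"
    using assms by (auto simp: sets_restrict_space)
  then show ?thesis
    using assms(1)
    by (simp add: normalized_lborel_def emeasure_restrict_space ennreal_times_divide
        mult.commute[of _ "emeasure lborel C"])
qed

text \<open>Unlike \<open>restrict_space M K\<close>, the restriction of \<open>M\<close> to \<open>K\<close> in the following sense keeps the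
  space and the \<open>\<sigma>\<close>-algebra of \<open>M\<close>: a set \<open>C\<close> gets the measure of \<open>C \<inter> K\<close>.\<close>
definition measure_restriction :: "'a measure \<Rightarrow> 'a set \<Rightarrow> 'a measure" where
  "measure_restriction M K = measure_of (space M) (sets M) (\<lambda>C. emeasure M (C \<inter> K))"

lemma sets_measure_restriction: "sets (measure_restriction M K) = sets M"
  by (simp add: measure_restriction_def)

lemma emeasure_measure_restriction:
  assumes "K \<in> sets M" "C \<in> sets M"
  shows "emeasure (measure_restriction M K) C = emeasure M (C \<inter> K)"
proof (rule emeasure_measure_of[OF measure_restriction_def])
  show "sets M \<subseteq> Pow (space M)" by (rule sets.space_closed)
  show "C \<in> sets (measure_restriction M K)"
    using assms by (simp add: sets_measure_restriction)
  show "positive (sets (measure_restriction M K)) (\<lambda>C. emeasure M (C \<inter> K))"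
    by (simp add: positive_def)
  show "countably_additive (sets (measure_restriction M K)) (\<lambda>C. emeasure M (C \<inter> K))"
  proof (rule countably_additiveI)
    fix A :: "nat \<Rightarrow> 'a set"
    assume A: "range A \<subseteq> sets (measure_restriction M K)" "disjoint_family A"
    have "(\<Sum>i. emeasure M (A i \<inter> K)) = emeasure M (\<Union>i. A i \<inter> K)"
      using A assms by (intro suminf_emeasure)
        (auto simp: sets_measure_restriction disjoint_family_on_def)
    then show "(\<Sum>i. emeasure M (A i \<inter> K)) = emeasure M ((\<Union>i. A i) \<inter> K)"
      by simp
  qed
qed

text \<open>\<open>M(K)\<close>: finite Borel measures on \<open>K\<close>, as measures on \<open>B\<close> vanishing on \<open>B - K\<close>.\<close>
definition finite_measures_on :: "(real ^ 'n) set \<Rightarrow> (real ^ 'n) set \<Rightarrow> (real ^ 'n) measure set" where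
  "finite_measures_on B K =
    {\<mu>. sets \<mu> = sets (restrict_space borel B) \<and> finite_measure \<mu> \<and> emeasure \<mu> (B - K) = 0}"

definition feasible :: "(real ^ 'n) set \<Rightarrow> (real ^ 'n) set \<Rightarrow> (real ^ 'n) measure set" where
  "feasible B K =
    {\<mu> \<in> finite_measures_on B K.
      \<forall>C \<in> sets (restrict_space borel B). emeasure \<mu> C \<le> emeasure (normalized_lborel B) C}"

text \<open>The supremum is taken in the extended reals, so that it is meaningful without a boundedness
  assumption. For \<open>B\<close> inside the unit box a polynomial is bounded on \<open>B\<close>, so it is integrable
  with respect to every feasible measure; see \<open>integrable_feasible\<close> below.\<close>
definition optimal_value ::
  "(real ^ 'n) set \<Rightarrow> (real ^ 'n) set \<Rightarrow> (real ^ 'n \<Rightarrow> real) \<Rightarrow> ereal" where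
  "optimal_value B K p = (SUP \<mu> \<in> feasible B K. ereal (\<integral>x. p x \<partial>\<mu>))"

definition optimal_solution ::
  "(real ^ 'n) set \<Rightarrow> (real ^ 'n) set \<Rightarrow> (real ^ 'n \<Rightarrow> real) \<Rightarrow> (real ^ 'n) measure \<Rightarrow> bool" where
  "optimal_solution B K p \<mu> \<longleftrightarrow>
    \<mu> \<in> feasible B K \<and> (\<forall>\<nu> \<in> feasible B K. (\<integral>x. p x \<partial>\<nu>) \<le> (\<integral>x. p x \<partial>\<mu>))"

lemma integrable_feasible:
  fixes B K :: "(real ^ 'n) set"
  assumes B: "B \<subseteq> {x. \<forall>i. x $ i \<in> {-1..1}}"
    and p: "real_polynomial_function p" and \<mu>: "\<mu> \<in> feasible B K"
  shows "integrable \<mu> p"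
proof -
  have s: "sets \<mu> = sets (restrict_space borel B)" and f: "finite_measure \<mu>"
    using \<mu> by (auto simp: feasible_def finite_measures_on_def)
  have sp: "space \<mu> = B"
    using sets_eq_imp_space_eq[OF s] by (simp add: space_restrict_space)
  have c: "continuous_on S p" for S
    by (rule continuous_on_polymonial_function)
      (use p in \<open>simp add: real_polynomial_function_eq\<close>)
  have sub: "B \<subseteq> cbox (\<chi> i. -1) (\<chi> i. 1)"
    using B by (auto simp: mem_box_cart)
  have "bounded (p ` cbox (\<chi> i. -1) (\<chi> i. 1))"
    by (intro compact_imp_bounded compact_continuous_image c compact_cbox)
  then obtain b where b: "\<And>x. x \<in> B \<Longrightarrow> norm (p x) \<le> b"
    using sub by (auto simp: bounded_iff)
  have "p \<in> borel_measurable (restrict_space borel B)"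
    by (intro measurable_restrict_space1 borel_measurable_continuous_onI c)
  then have "p \<in> borel_measurable \<mu>"
    using measurable_cong_sets[OF s refl] by blast
  then show ?thesis
    using b sp by (intro finite_measure.integrable_const_bound[OF f, of _ b]) auto
qed

end

theory Submission
  imports Defs
begin

text \<open>
  A feasible \<open>\<nu>\<close> vanishes outside \<open>K\<close> and is dominated by \<open>\<mu>\<^sub>2\<close>; replacing a set by its intersection
  with \<open>K\<close> therefore shows that \<open>\<nu>\<close> is dominated by the restriction \<open>\<mu>\<^sub>1_star\<close>, which is itself
  feasible (\<open>feasible_iff_dominated\<close>). The program thus asks to maximize \<open>\<integral>p \<partial>\<nu>\<close> over all
  measures below one finite measure \<open>\<mu>\<^sub>1_star\<close> that belongs to the family, and \<open>p\<close> is positive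
  almost everywhere for \<open>\<mu>\<^sub>1_star\<close>.

  The rest is strict monotonicity of the integral in the measure
  (\<open>integral_mono_dominated_measure\<close>). The difference \<open>\<delta> = \<mu>\<^sub>1_star - \<nu>\<close> is a measure, and
  \<open>\<integral>p \<partial>\<mu>\<^sub>1_star = \<integral>p \<partial>\<nu> + \<integral>p \<partial>\<delta>\<close> with a nonnegative last summand. If that summand is zero then
  \<open>p = 0\<close> almost everywhere for \<open>\<delta>\<close>. But \<open>p > 0\<close> almost everywhere for \<open>\<delta>\<close>, because a null set
  of \<open>\<mu>\<^sub>1_star\<close> is a null set of \<open>\<delta>\<close>. Hence \<open>\<delta> = 0\<close>, that is, \<open>\<nu> = \<mu>\<^sub>1_star\<close>.
\<close>

lemma nn_integral_sum_of_measures: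
  assumes sets [measurable_cong]: "sets N = sets M" "sets D = sets M"
    and sum: "\<And>A. A \<in> sets M \<Longrightarrow> emeasure M A = emeasure N A + emeasure D A"
    and f: "f \<in> borel_measurable M"
  shows "(\<integral>\<^sup>+x. f x \<partial>M) = (\<integral>\<^sup>+x. f x \<partial>N) + (\<integral>\<^sup>+x. f x \<partial>D)"
  using f
proof (induction rule: borel_measurable_induct)
  case (cong f g)
  moreover have "space N = space M" "space D = space M"
    using sets by (auto dest: sets_eq_imp_space_eq)
  ultimately have "(\<integral>\<^sup>+x. f x \<partial>L) = (\<integral>\<^sup>+x. g x \<partial>L)" if "L \<in> {M, N, D}" for L
    using that by (intro nn_integral_cong) auto
  with cong show ?case
    by simp
next
  case (set A)
  then show ?case
    using sets sum by simp
next
  case (mult u c)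
  then show ?case
    by (simp add: nn_integral_cmult distrib_left)
next
  case (add u v)
  then show ?case
    by (simp add: nn_integral_add algebra_simps)
next
  case (seq U)
  have [measurable]: "U i \<in> borel_measurable M" for i
    using seq by auto
  have "(\<integral>\<^sup>+x. (SUP i. U i) x \<partial>M) = (SUP i. (\<integral>\<^sup>+x. U i x \<partial>N) + (\<integral>\<^sup>+x. U i x \<partial>D))"
    using seq by (simp add: image_comp nn_integral_monotone_convergence_SUP)
  also have "\<dots> = (SUP i. \<integral>\<^sup>+x. U i x \<partial>N) + (SUP i. \<integral>\<^sup>+x. U i x \<partial>D)"
    using seq by (intro ennreal_SUP_add)
      (auto simp: incseq_def le_fun_def intro!: nn_integral_mono)
  also have "\<dots> = (\<integral>\<^sup>+x. (SUP i. U i) x \<partial>N) + (\<integral>\<^sup>+x. (SUP i. U i) x \<partial>D)"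
    using seq by (simp add: image_comp nn_integral_monotone_convergence_SUP)
  finally show ?case .
qed

text \<open>The integral against \<open>M\<close> exceeds the one against \<open>N\<close> by the integral against the
  measure \<open>M - N\<close>. As \<open>M - N\<close> is absolutely continuous with respect to \<open>M\<close>, a function that is
  positive almost everywhere for \<open>M\<close> can have a zero integral against \<open>M - N\<close> only if that
  difference is the zero measure.\<close>
lemma integral_mono_dominated_measure:
  fixes p :: "'a \<Rightarrow> real"
  assumes M: "finite_measure M" and N: "finite_measure N" and sets: "sets N = sets M"
    and le: "\<And>A. A \<in> sets M \<Longrightarrow> emeasure N A \<le> emeasure M A"
    and pos: "AE x in M. p x > 0"
    and int: "integrable M p" "integrable N p"
  shows "(\<integral>x. p x \<partial>N) \<le> (\<integral>x. p x \<partial>M)"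
    and "(\<integral>x. p x \<partial>N) = (\<integral>x. p x \<partial>M) \<Longrightarrow> N = M"
proof -
  define D where "D = diff_measure M N"
  have setsD: "sets D = sets M"
    by (simp add: D_def)
  have D: "emeasure D A = emeasure M A - emeasure N A" if "A \<in> sets M" for A
    unfolding D_def by (rule emeasure_diff_measure[OF M N sets[symmetric] le that])
  have sum: "emeasure M A = emeasure N A + emeasure D A" if "A \<in> sets M" for A
    using le[OF that] by (simp add: D[OF that] add_diff_inverse_ennreal)
  have posN: "AE x in N. p x > 0"
    by (rule absolutely_continuous_AE[OF sets _ pos])
      (use sets sum in \<open>auto simp: absolutely_continuous_def null_sets_def\<close>)
  have posD: "AE x in D. p x > 0"
    by (rule absolutely_continuous_AE[OF setsD _ pos])
      (use setsD sum in \<open>auto simp: absolutely_continuous_def null_sets_def\<close>)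
  have meas: "(\<lambda>x. ennreal (p x)) \<in> borel_measurable M"
    using int(1) by measurable
  have nn: "0 \<le> (\<integral>x. p x \<partial>N)" "0 \<le> (\<integral>x. p x \<partial>M)"
    using pos posN by (auto intro!: integral_nonneg_AE elim: AE_mp)
  have eq: "ennreal (\<integral>x. p x \<partial>M) = ennreal (\<integral>x. p x \<partial>N) + (\<integral>\<^sup>+x. p x \<partial>D)"
  proof -
    have "ennreal (\<integral>x. p x \<partial>M) = (\<integral>\<^sup>+x. p x \<partial>M)"
      using int(1) pos by (intro nn_integral_eq_integral[symmetric]) auto
    moreover have "ennreal (\<integral>x. p x \<partial>N) = (\<integral>\<^sup>+x. p x \<partial>N)"
      using int(2) posN by (intro nn_integral_eq_integral[symmetric]) auto
    ultimately show ?thesis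
      using nn_integral_sum_of_measures[OF sets setsD sum meas] by simp
  qed
  show "(\<integral>x. p x \<partial>N) \<le> (\<integral>x. p x \<partial>M)"
  proof -
    have "ennreal (\<integral>x. p x \<partial>N) \<le> ennreal (\<integral>x. p x \<partial>M)"
      by (simp add: eq)
    then show ?thesis
      using nn by simp
  qed
  assume "(\<integral>x. p x \<partial>N) = (\<integral>x. p x \<partial>M)"
  then have "ennreal (\<integral>x. p x \<partial>N) + (\<integral>\<^sup>+x. p x \<partial>D) = ennreal (\<integral>x. p x \<partial>N) + 0"
    using eq by simp
  then have "(\<integral>\<^sup>+x. p x \<partial>D) = 0"
    by (subst (asm) ennreal_add_left_cancel) simp
  moreover have "(\<lambda>x. ennreal (p x)) \<in> borel_measurable D"
    using meas by (simp cong: measurable_cong_sets add: setsD)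
  ultimately have "AE x in D. ennreal (p x) = 0"
    by (simp add: nn_integral_0_iff_AE)
  with posD have "AE x in D. False"
    by eventually_elim (simp add: ennreal_eq_0_iff)
  then have null: "emeasure D (space D) = 0"
    by (simp add: AE_iff_null null_sets_def)
  show "N = M"
  proof (rule measure_eqI[OF sets])
    fix A assume "A \<in> sets N"
    then have A: "A \<in> sets M"
      by (simp add: sets)
    have "emeasure D A \<le> emeasure D (space D)"
      by (rule emeasure_space)
    then show "emeasure N A = emeasure M A"
      using sum[OF A] null by simp
  qed
qed

lemma measure_restriction_eq_density:
  assumes "K \<in> sets M"
  shows "measure_restriction M K = density M (indicator K)"
  by (rule measure_eqI)
    (use assms in \<open>simp_all add: sets_measure_restriction emeasure_measure_restriction
      emeasure_restricted Int_commute\<close>)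

lemma integral_measure_restriction:
  fixes f :: "'a \<Rightarrow> real"
  assumes "K \<in> sets M" "f \<in> borel_measurable M"
  shows "(\<integral>x. f x \<partial>measure_restriction M K) = (\<integral>x\<in>K. f x \<partial>M)"
proof -
  have "measure_restriction M K = density M (\<lambda>x. ennreal (indicator K x))"
    by (simp add: measure_restriction_eq_density assms ennreal_indicator)
  then show ?thesis
    using assms by (simp add: integral_density set_lebesgue_integral_def)
qed

lemma AE_measure_restriction_iff:
  assumes "K \<in> sets M"
  shows "(AE x in measure_restriction M K. P x) \<longleftrightarrow> (AE x in M. x \<in> K \<longrightarrow> P x)"
proof -
  have "(AE x in density M (indicator K). P x) \<longleftrightarrow> (AE x in M. 0 < (indicator K x :: ennreal) \<longrightarrow> P x)"
    using assms by (intro AE_density) simp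
  also have "\<dots> \<longleftrightarrow> (AE x in M. x \<in> K \<longrightarrow> P x)"
    by (intro AE_cong) (auto simp: indicator_def)
  finally show ?thesis
    unfolding measure_restriction_eq_density[OF assms] .
qed

lemma finite_measure_normalized_lborel:
  fixes B :: "(real ^ 'n) set"
  assumes B: "B \<in> sets borel" and box: "B \<subseteq> {x. \<forall>i. x $ i \<in> {-1..1}}"
  shows "finite_measure (normalized_lborel B)"
proof (rule finite_measureI)
  have "B \<subseteq> cbox (\<chi> i. -1) (\<chi> i. 1)"
    using box by (auto simp: mem_box_cart)
  then have "emeasure lborel B \<le> emeasure lborel (cbox (\<chi> i. -1) (\<chi> i. 1) :: (real ^ 'n) set)"
    by (intro emeasure_mono) auto
  also have "\<dots> < \<infinity>"
    by (rule emeasure_lborel_cbox_finite)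
  finally have "emeasure lborel B < \<infinity>" .
  moreover have "space (normalized_lborel B) = B"
    using sets_eq_imp_space_eq[OF sets_normalized_lborel] by (simp add: space_restrict_space)
  moreover have "B \<in> sets (restrict_space borel B)"
    using B by (simp add: sets_restrict_space_iff)
  ultimately show "emeasure (normalized_lborel B) (space (normalized_lborel B)) \<noteq> \<infinity>"
    using B by (simp add: emeasure_normalized_lborel ennreal_divide_eq_top_iff)
qed

lemma AE_normalized_lborel:
  assumes "B \<in> sets borel" "AE x in lborel. P x"
  shows "AE x in normalized_lborel B. P x"
proof -
  have "AE x in restrict_space lborel B. P x"
    using assms by (subst AE_restrict_space_iff) auto
  then show ?thesis
    unfolding normalized_lborel_def
    by (rule absolutely_continuous_AE[rotated 2])
      (auto simp: absolutely_continuous_def null_sets_def)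
qed

text \<open>A set \<open>C\<close> has the same measure as \<open>C \<inter> K\<close> when \<open>B - K\<close> is null, so the bound by the
  normalized Lebesgue measure is only ever tested inside \<open>K\<close>. Conversely, a measure below the restriction
  vanishes outside \<open>K\<close> because the restriction does, and it is finite because \<open>B\<close> lies in a
  box. The constraints of the program thus reduce to one inequality between measures.\<close>
lemma feasible_iff_dominated:
  fixes B K :: "(real ^ 'n) set"
  assumes B: "B \<in> sets borel" and box: "B \<subseteq> {x. \<forall>i. x $ i \<in> {-1..1}}"
    and K: "K \<in> sets (restrict_space borel B)"
  defines "R \<equiv> measure_restriction (normalized_lborel B) K"
  shows "\<nu> \<in> feasible B K \<longleftrightarrow>
    sets \<nu> = sets R \<and> (\<forall>C \<in> sets R. emeasure \<nu> C \<le> emeasure R C)"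
proof -
  let ?M = "normalized_lborel B"
  have sR: "sets R = sets (restrict_space borel B)"
    by (simp add: R_def sets_measure_restriction sets_normalized_lborel)
  have R: "emeasure R C = emeasure ?M (C \<inter> K)" if "C \<in> sets R" for C
    using that K by (simp add: R_def emeasure_measure_restriction sets_measure_restriction
        sets_normalized_lborel)
  have sB: "B \<in> sets R"
    using B by (simp add: sR sets_restrict_space_iff)
  have sK: "K \<in> sets R"
    using K by (simp add: sR)
  show ?thesis
  proof (intro iffI conjI ballI)
    assume \<nu>: "\<nu> \<in> feasible B K"
    then show s: "sets \<nu> = sets R"
      by (simp add: feasible_def finite_measures_on_def sR)
    fix C assume C: "C \<in> sets R"
    have [measurable]: "C \<in> sets \<nu>" "K \<in> sets \<nu>" "B \<in> sets \<nu>"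
      using C sK sB s by auto
    have "C \<subseteq> B"
      using C by (auto simp: sR sets_restrict_space)
    then have "emeasure \<nu> C \<le> emeasure \<nu> ((C \<inter> K) \<union> (B - K))"
      by (intro emeasure_mono) auto
    also have "\<dots> \<le> emeasure \<nu> (C \<inter> K) + emeasure \<nu> (B - K)"
      by (intro emeasure_subadditive) auto
    also have "\<dots> = emeasure \<nu> (C \<inter> K)"
      using \<nu> by (simp add: feasible_def finite_measures_on_def)
    also have "\<dots> \<le> emeasure ?M (C \<inter> K)"
      using \<nu> C sK sR by (auto simp: feasible_def)
    also have "\<dots> = emeasure R C"
      using C by (simp add: R)
    finally show "emeasure \<nu> C \<le> emeasure R C" .
  next
    assume \<nu>: "sets \<nu> = sets R \<and> (\<forall>C \<in> sets R. emeasure \<nu> C \<le> emeasure R C)"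
    have le: "emeasure \<nu> C \<le> emeasure ?M C" if "C \<in> sets R" for C
    proof -
      have "emeasure R C \<le> emeasure ?M C"
        using that by (subst R) (auto intro!: emeasure_mono simp: sR sets_normalized_lborel)
      then show ?thesis
        using \<nu> that by (meson order_trans)
    qed
    have "emeasure \<nu> (B - K) \<le> emeasure R (B - K)"
      using \<nu> sB sK by auto
    also have "\<dots> = 0"
    proof -
    have "(B - K) \<inter> K = {}"
      by blast
    then show ?thesis
      using R[of "B - K"] sB sK by (simp add: sets.Diff)
  qed
    finally have null: "emeasure \<nu> (B - K) = 0"
      by simp
    have "finite_measure \<nu>"
    proof (rule finite_measureI)
      interpret M: finite_measure ?M
        by (rule finite_measure_normalized_lborel[OF B box])
      have "space \<nu> \<in> sets R"
        using \<nu> by (metis sets.top)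
      then have "emeasure \<nu> (space \<nu>) \<le> emeasure ?M (space \<nu>)"
        by (rule le)
      also have "\<dots> < \<infinity>"
        using M.emeasure_finite[of "space \<nu>"] unfolding infinity_ennreal_def
        by (metis top.not_eq_extremum)
      finally show "emeasure \<nu> (space \<nu>) \<noteq> \<infinity>"
        by simp
    qed
    then show "\<nu> \<in> feasible B K"
      using \<nu> null le by (simp add: feasible_def finite_measures_on_def sR)
  qed
qed

theorem theorem3p1:
  fixes B K :: "(real ^ 'n) set" and p :: "real ^ 'n \<Rightarrow> real"
    and \<mu>\<^sub>2 \<mu>\<^sub>1_star :: "(real ^ 'n) measure"
  assumes "B \<in> sets borel" and "B \<subseteq> {x. \<forall>i. x $ i \<in> {-1..1}}"
    and "K \<in> sets (restrict_space borel B)"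
    and "real_polynomial_function p"
    and "AE x in lborel. x \<in> K \<longrightarrow> p x > 0"
  defines "\<mu>\<^sub>2 \<equiv> normalized_lborel B"
    and "\<mu>\<^sub>1_star \<equiv> measure_restriction \<mu>\<^sub>2 K"
  shows "(\<forall>\<mu>. optimal_solution B K p \<mu> \<longleftrightarrow> \<mu> = \<mu>\<^sub>1_star)
    \<and> optimal_value B K p = ereal (\<integral>x. p x \<partial>\<mu>\<^sub>1_star)
    \<and> (\<integral>x. p x \<partial>\<mu>\<^sub>1_star) = (\<integral>x\<in>K. p x \<partial>\<mu>\<^sub>2)
    \<and> ((\<forall>x. p x = 1) \<longrightarrow> optimal_value B K p = ereal (measure lborel K / 2 ^ CARD('n)))"
proof -
  note B = assms(1) and box = assms(2) and K = assms(3) and p = assms(4)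
  let ?R = "\<mu>\<^sub>1_star"
  note dom = feasible_iff_dominated[OF B box K, folded \<mu>\<^sub>2_def, folded \<mu>\<^sub>1_star_def]
  have K': "K \<in> sets \<mu>\<^sub>2"
    using K by (simp add: \<mu>\<^sub>2_def sets_normalized_lborel)
  have fin: "finite_measure \<nu>" if "\<nu> \<in> feasible B K" for \<nu>
    using that by (simp add: feasible_def finite_measures_on_def)
  have R: "?R \<in> feasible B K"
    by (simp add: dom)
  have pos: "AE x in ?R. p x > 0"
    unfolding \<mu>\<^sub>1_star_def AE_measure_restriction_iff[OF K'] unfolding \<mu>\<^sub>2_def
    by (rule AE_normalized_lborel[OF B assms(5)])
  have int: "integrable \<nu> p" if "\<nu> \<in> feasible B K" for \<nu>
    by (rule integrable_feasible[OF box p that])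
  have bound: "(\<integral>x. p x \<partial>\<nu>) \<le> (\<integral>x. p x \<partial>?R)"
    and unique: "(\<integral>x. p x \<partial>\<nu>) = (\<integral>x. p x \<partial>?R) \<Longrightarrow> \<nu> = ?R" if \<nu>: "\<nu> \<in> feasible B K" for \<nu>
    using integral_mono_dominated_measure[OF fin[OF R] fin[OF \<nu>] _ _ pos int[OF R] int[OF \<nu>]]
      \<nu> dom by auto
  have solution: "optimal_solution B K p \<nu> \<longleftrightarrow> \<nu> = ?R" for \<nu>
    using R bound unique by (auto simp: optimal_solution_def intro: antisym)
  have optimum: "optimal_value B K p = ereal (\<integral>x. p x \<partial>?R)"
    unfolding optimal_value_def
    by (intro antisym SUP_least SUP_upper[OF R]) (simp add: bound)
  have "p \<in> borel_measurable \<mu>\<^sub>2"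
    using borel_measurable_integrable[OF int[OF R]]
      measurable_cong_sets[OF sets_measure_restriction[of \<mu>\<^sub>2 K] refl, of borel]
    unfolding \<mu>\<^sub>1_star_def by blast
  then have restricted: "(\<integral>x. p x \<partial>?R) = (\<integral>x\<in>K. p x \<partial>\<mu>\<^sub>2)"
    unfolding \<mu>\<^sub>1_star_def by (rule integral_measure_restriction[OF K'])
  have "(\<integral>x. p x \<partial>?R) = measure lborel K / 2 ^ CARD('n)" if "\<forall>x. p x = 1"
  proof -
    have "(\<integral>x. p x \<partial>?R) = measure \<mu>\<^sub>2 K"
      using that K' sets.sets_into_space[OF K'] unfolding restricted
      by (simp add: set_lebesgue_integral_def Int_absorb2)
    also have "\<dots> = measure lborel K / 2 ^ CARD('n)"
    proof -
      have "(1 / 2 ^ CARD('n) :: ennreal) = ennreal (1 / 2 ^ CARD('n))"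
        by (simp add: divide_ennreal[symmetric] ennreal_power[symmetric])
      then have "\<mu>\<^sub>2 = scale_measure (ennreal (1 / 2 ^ CARD('n))) (restrict_space lborel B)"
        by (simp add: \<mu>\<^sub>2_def normalized_lborel_def)
      then show ?thesis
        using B sets.sets_into_space[OF K]
        by (simp add: space_restrict_space measure_restrict_space)
    qed
    finally show ?thesis .
  qed
  then show ?thesis
    using solution optimum restricted by metis
qed

end
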